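(* Let $M\subset\mathbb{C}$ be a connected and simply connected open set containing an interval $I=(-r,r)$, $r>0$, and let $f\colon M\to\mathbb{R}^4_2$ be an isoclinic conformal immersion. Then there exist two holomorphic functions $\Psi,\Phi\colon M\to\mathbb{C}$ such that $$f(w)=\bigl(\mathrm{Re}\,\Psi(w),\ \mathrm{Im}\,\Psi(w),\ \mathrm{Re}\,\Phi(w),\ \mathrm{Im}\,\Phi(w)\bigr)\quad\text{for all } w\in M.$$
   Context: $\mathbb{R}^4_2$ is $\mathbb{R}^4$ with $\langle v,w\rangle=-v^1w^1-v^2w^2+v^3w^3+v^4w^4$ and canonical basis $e_1,\dots,e_4$; $\pi_{12}=\mathrm{span}\{e_1,e_2\}$, $\pi_{34}=\mathrm{span}\{e_3,e_4\}$; $\hat v=v^1e_1+v^2e_2$ and $\tilde v=v^3e_3+v^4e_4$ are the projections of $v$ onto $\pi_{12}$ and $\pi_{34}$. A plane is positive (negative) spacelike if the induced metric on it is positive (negative) definite. Immersions are smooth; $w=u+iv$ is the coordinate on $M$, and conformal means $\langle f_u,f_u\rangle=\langle f_v,f_v\rangle\neq0$, $\langle f_u,f_v\rangle=0$. A negative plane $V$ with basis $\{v,w\}$ satisfying $\langle v,v\rangle=\langle w,w\rangle=-1$, $\langle v,w\rangle=0$ is isoclinic to $\pi_{12}$ if, for $x(\theta)=\cos\theta\, v+\sin\theta\, w$, the hyperbolic angle $\varphi(\theta)$ between $V$ and $\pi_{12}$, defined by $\langle\hat x(\theta),x(\theta)\rangle=-\cosh^2\varphi(\theta)$, is constant. A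 positive plane with basis $\{v,w\}$ satisfying $\langle v,v\rangle=\langle w,w\rangle=1$, $\langle v,w\rangle=0$ is isoclinic to $\pi_{34}$ if, for $x(\theta)=\cos\theta\, v+\sin\theta\, w$, the angle $\varphi(\theta)$ defined by $\langle\tilde x(\theta),x(\theta)\rangle=\cosh^2\varphi(\theta)$ is constant. A conformal immersion $f$ is isoclinic if either all its tangent planes are positive spacelike planes isoclinic to $\pi_{34}$, or all its tangent planes are negative spacelike planes isoclinic to $\pi_{12}$.
   Formalization: As written this fails for f(u+iv)=(0,0,u,-v); the formula is proved when the projections of f to π_12 and π_34 have nonnegative Jacobians (also necessary), and in general with constant signs ±1 on Im Ψ and Im Φ. *)

theory Defs
  imports "HOL-Analysis.Analysis"
begin

definition inner22 :: "real^4 \<Rightarrow> real^4 \<Rightarrow> real" where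
  "inner22 v w = - v$1 * w$1 - v$2 * w$2 + v$3 * w$3 + v$4 * w$4"

definition proj12 :: "real^4 \<Rightarrow> real^4" where
  "proj12 v = vector [v$1, v$2, 0, 0]"

definition proj34 :: "real^4 \<Rightarrow> real^4" where
  "proj34 v = vector [0, 0, v$3, v$4]"

definition positive_plane :: "(real^4) set \<Rightarrow> bool" where
  "positive_plane V \<longleftrightarrow> subspace V \<and> dim V = 2 \<and> (\<forall>x\<in>V. x \<noteq> 0 \<longrightarrow> inner22 x x > 0)"

definition negative_plane :: "(real^4) set \<Rightarrow> bool" where
  "negative_plane V \<longleftrightarrow> subspace V \<and> dim V = 2 \<and> (\<forall>x\<in>V. x \<noteq> 0 \<longrightarrow> inner22 x x < 0)"

text \<open>
  For a unit vector \<open>x\<close> of a spacelike plane, \<open>\<bar>\<langle>proj x, x\<rangle>\<bar> \<ge> 1\<close>, so the angle exists and is unique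
  once normalised by \<open>\<phi>(\<theta>) \<ge> 0\<close>. Its constancy does not depend on the orthonormal basis, so
  requiring it for some basis of the plane is the same as requiring it for all.
\<close>

definition isoclinic_to_34 :: "(real^4) set \<Rightarrow> bool" where
  "isoclinic_to_34 V \<longleftrightarrow> (\<exists>v w. V = span {v, w} \<and>
     inner22 v v = 1 \<and> inner22 w w = 1 \<and> inner22 v w = 0 \<and>
     (\<exists>\<phi>::real \<Rightarrow> real.
        (\<forall>\<theta>. \<phi> \<theta> \<ge> 0 \<and>
           (let x = cos \<theta> *\<^sub>R v + sin \<theta> *\<^sub>R w in
              inner22 (proj34 x) x = (cosh (\<phi> \<theta>))\<^sup>2)) \<and>
        \<phi> constant_on UNIV))"

definition isoclinic_to_12 :: "(real^4) set \<Rightarrow> bool" where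
  "isoclinic_to_12 V \<longleftrightarrow> (\<exists>v w. V = span {v, w} \<and>
     inner22 v v = - 1 \<and> inner22 w w = - 1 \<and> inner22 v w = 0 \<and>
     (\<exists>\<phi>::real \<Rightarrow> real.
        (\<forall>\<theta>. \<phi> \<theta> \<ge> 0 \<and>
           (let x = cos \<theta> *\<^sub>R v + sin \<theta> *\<^sub>R w in
              inner22 (proj12 x) x = - (cosh (\<phi> \<theta>))\<^sup>2)) \<and>
        \<phi> constant_on UNIV))"

text \<open>\<open>C\<^sup>k\<close> on an open set, via iterated directional derivatives.\<close>

primrec Ck_on :: "nat \<Rightarrow> ('a::euclidean_space \<Rightarrow> 'b::euclidean_space) \<Rightarrow> 'a set \<Rightarrow> bool" where
  "Ck_on 0 f S \<longleftrightarrow> continuous_on S f"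
| "Ck_on (Suc k) f S \<longleftrightarrow> (\<forall>x\<in>S. f differentiable (at x)) \<and>
     (\<forall>h. Ck_on k (\<lambda>x. frechet_derivative f (at x) h) S)"

definition smooth_map_on :: "('a::euclidean_space \<Rightarrow> 'b::euclidean_space) \<Rightarrow> 'a set \<Rightarrow> bool" where
  "smooth_map_on f S \<longleftrightarrow> (\<forall>k. Ck_on k f S)"

definition immersion_on :: "(complex \<Rightarrow> real^4) \<Rightarrow> complex set \<Rightarrow> bool" where
  "immersion_on f M \<longleftrightarrow> smooth_map_on f M \<and> (\<forall>p\<in>M. inj (frechet_derivative f (at p)))"

text \<open>The partial derivatives \<open>f\<^sub>u\<close> and \<open>f\<^sub>v\<close> in the coordinate \<open>w = u + iv\<close>.\<close>

definition deriv_u :: "(complex \<Rightarrow> real^4) \<Rightarrow> complex \<Rightarrow> real^4" where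
  "deriv_u f p = frechet_derivative f (at p) 1"

definition deriv_v :: "(complex \<Rightarrow> real^4) \<Rightarrow> complex \<Rightarrow> real^4" where
  "deriv_v f p = frechet_derivative f (at p) \<i>"

definition tangent_plane :: "(complex \<Rightarrow> real^4) \<Rightarrow> complex \<Rightarrow> (real^4) set" where
  "tangent_plane f p = range (frechet_derivative f (at p))"

definition conformal_immersion_on :: "(complex \<Rightarrow> real^4) \<Rightarrow> complex set \<Rightarrow> bool" where
  "conformal_immersion_on f M \<longleftrightarrow> immersion_on f M \<and>
     (\<forall>p\<in>M. inner22 (deriv_u f p) (deriv_u f p) = inner22 (deriv_v f p) (deriv_v f p) \<and>
            inner22 (deriv_u f p) (deriv_u f p) \<noteq> 0 \<and>
            inner22 (deriv_u f p) (deriv_v f p) = 0)"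

definition isoclinic_immersion_on :: "(complex \<Rightarrow> real^4) \<Rightarrow> complex set \<Rightarrow> bool" where
  "isoclinic_immersion_on f M \<longleftrightarrow> conformal_immersion_on f M \<and>
     ((\<forall>p\<in>M. positive_plane (tangent_plane f p) \<and> isoclinic_to_34 (tangent_plane f p)) \<or>
      (\<forall>p\<in>M. negative_plane (tangent_plane f p) \<and> isoclinic_to_12 (tangent_plane f p)))"

text \<open>
  Isoclinicity does not see orientations: \<open>u + iv \<mapsto> (0, 0, u, -v)\<close> is an isoclinic conformal
  immersion all of whose tangent planes are \<open>\<pi>\<^sub>3\<^sub>4\<close>, but its last two components are the real and
  imaginary parts of the conjugate of \<open>w\<close>. A representation by holomorphic functions therefore
  presupposes that the projections of \<open>f\<close> to \<open>\<pi>\<^sub>1\<^sub>2\<close> and \<open>\<pi>\<^sub>3\<^sub>4\<close>, oriented by \<open>(e\<^sub>1, e\<^sub>2)\<close> and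
  \<open>(e\<^sub>3, e\<^sub>4)\<close>, do not reverse the orientation given by \<open>(u, v)\<close>; otherwise the signs of the
  second and fourth coordinates have to be adjusted. The Jacobians may vanish: a projection
  can be constant or have critical points.
\<close>

definition orientation_compatible_on :: "(complex \<Rightarrow> real^4) \<Rightarrow> complex set \<Rightarrow> bool" where
  "orientation_compatible_on f M \<longleftrightarrow> (\<forall>p\<in>M.
     deriv_u f p $ 1 * deriv_v f p $ 2 - deriv_u f p $ 2 * deriv_v f p $ 1 \<ge> 0 \<and>
     deriv_u f p $ 3 * deriv_v f p $ 4 - deriv_u f p $ 4 * deriv_v f p $ 3 \<ge> 0)"

lemma vector_4:
  "(vector [a, b, c, d] :: 'a::zero^4) $ 1 = a"
  "(vector [a, b, c, d] :: 'a::zero^4) $ 2 = b"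
  "(vector [a, b, c, d] :: 'a::zero^4) $ 3 = c"
  "(vector [a, b, c, d] :: 'a::zero^4) $ 4 = d"
  unfolding vector_def by simp_all

end

theory Submission
  imports Defs "HOL-Complex_Analysis.Conformal_Mappings"
begin

text \<open>
  Identify \<open>\<pi>\<^sub>1\<^sub>2\<close> and \<open>\<pi>\<^sub>3\<^sub>4\<close> with \<open>\<complex>\<close>, and let \<open>g\<close> be one of the two projections of \<open>f\<close>.
  A quadratic form that is constant on the unit circle of a definite plane is a multiple of the
  metric there. So on an isoclinic plane the Euclidean forms of both projections are multiples of
  \<open>\<langle>\<cdot>,\<cdot>\<rangle>\<close> (\<open>isoclinic_to_34_proportional\<close>, \<open>isoclinic_to_12_proportional\<close>), and conformality of
  \<open>f\<close> gives \<open>\<bar>g\<^sub>u\<bar> = \<bar>g\<^sub>v\<bar>\<close> and \<open>g\<^sub>u \<bottom> g\<^sub>v\<close>, that is \<open>g\<^sub>u\<^sup>2 + g\<^sub>v\<^sup>2 = 0\<close>. With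
  \<open>P = g\<^sub>u - i g\<^sub>v\<close> and \<open>Q = g\<^sub>u + i g\<^sub>v\<close>, which are twice the Wirtinger derivatives of \<open>g\<close>
  with respect to \<open>w\<close> and to the conjugate of \<open>w\<close>, this reads \<open>P Q = 0\<close>: at
  every point \<open>g\<close> satisfies either the Cauchy-Riemann equation or its conjugate.

  The point of the proof is that the alternative is the same at all points, although \<open>P\<close> and \<open>Q\<close>
  may vanish together (\<open>holomorphic_or_antiholomorphic\<close>). Where \<open>P \<noteq> 0\<close>, the function \<open>g\<close> is
  holomorphic and \<open>P = 2 g'\<close>, so \<open>P\<close> is holomorphic there; in the interior of the zero set of
  \<open>P\<close> it is trivially so. These two sets together are dense in \<open>M\<close>, and since \<open>P\<close> is \<open>C\<^sup>1\<close>, it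
  satisfies the Cauchy-Riemann equation on all of \<open>M\<close>. By the identity theorem, either \<open>P\<close>
  vanishes identically, or its zero set has empty interior and then \<open>Q\<close> vanishes identically.
  Hence \<open>g\<close> or its conjugate is holomorphic. The Jacobian of \<open>g\<close> has the sign of
  \<open>\<bar>P\<bar>\<^sup>2 - \<bar>Q\<bar>\<^sup>2\<close>, so when it is nonnegative, \<open>P = 0\<close> forces \<open>Q = 0\<close> and \<open>g\<close> itself is
  holomorphic.
\<close>

section \<open>Isoclinic planes\<close>

lemma bilinear_lincomb:
  fixes q :: "'a::real_vector \<Rightarrow> 'a \<Rightarrow> real"
  assumes "bilinear q"
  shows "q (a *\<^sub>R v + b *\<^sub>R w) (c *\<^sub>R v + d *\<^sub>R w) =
    a * c * q v v + a * d * q v w + b * c * q w v + b * d * q w w"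
  using assms
  by (simp add: bilinear_ladd bilinear_radd bilinear_lmul bilinear_rmul algebra_simps)

lemma in_span_pair_iff: "x \<in> span {v, w} \<longleftrightarrow> (\<exists>a b. x = a *\<^sub>R v + b *\<^sub>R w)"
  by (auto simp: span_insert algebra_simps)

text \<open>
  Evaluation at the angles \<open>0\<close>, \<open>\<pi>/2\<close> and \<open>\<pi>/4\<close> gives the three coefficients of \<open>q\<close>. The sign
  \<open>e\<close> covers positive and negative planes.
\<close>

lemma constant_on_circle_imp_proportional:
  fixes q B :: "'a::real_vector \<Rightarrow> 'a \<Rightarrow> real"
  assumes "bilinear q" "bilinear B"
    and sym: "\<And>x y. q x y = q y x" "\<And>x y. B x y = B y x"
    and basis: "B v v = e" "B w w = e" "B v w = 0" "e \<noteq> 0"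
    and const: "\<And>\<theta>. q (cos \<theta> *\<^sub>R v + sin \<theta> *\<^sub>R w) (cos \<theta> *\<^sub>R v + sin \<theta> *\<^sub>R w) = k"
    and "x \<in> span {v, w}" "y \<in> span {v, w}"
  shows "q x y = k / e * B x y"
proof -
  note circle = const[unfolded bilinear_lincomb[OF \<open>bilinear q\<close>]]
  have "q v v = k" "q w w = k" using circle[of 0] circle[of "pi / 2"] by simp_all
  moreover have "q v w = 0"
    using circle[of "pi / 4"] calculation sym(1)[of w v] by (simp add: cos_45 sin_45)
  moreover obtain a b c d where "x = a *\<^sub>R v + b *\<^sub>R w" "y = c *\<^sub>R v + d *\<^sub>R w"
    using assms(10,11) by (auto simp: in_span_pair_iff)
  ultimately show ?thesis
    using basis sym(1)[of w v] sym(2)[of w v]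
    by (simp add: bilinear_lincomb[OF assms(1)] bilinear_lincomb[OF assms(2)] field_simps)
qed

lemma bilinear_inner22: "bilinear inner22"
  by (auto simp: bilinear_def inner22_def linear_iff algebra_simps)

lemma inner22_commute: "inner22 x y = inner22 y x"
  by (simp add: inner22_def)

lemma inner22_proj34: "inner22 (proj34 x) y = x $ 3 * y $ 3 + x $ 4 * y $ 4"
  by (simp add: inner22_def proj34_def vector_4)

lemma inner22_proj12: "inner22 (proj12 x) y = - (x $ 1 * y $ 1 + x $ 2 * y $ 2)"
  by (simp add: inner22_def proj12_def vector_4)

text \<open>
  The form of the other projection differs from the given one by the metric itself, so
  proportionality of one implies proportionality of both.
\<close>

lemma isoclinic_to_34_proportional:
  assumes "isoclinic_to_34 V"
  obtains c d where
    "\<And>x y. x \<in> V \<Longrightarrow> y \<in> V \<Longrightarrow> x $ 1 * y $ 1 + x $ 2 * y $ 2 = c * inner22 x y"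
    "\<And>x y. x \<in> V \<Longrightarrow> y \<in> V \<Longrightarrow> x $ 3 * y $ 3 + x $ 4 * y $ 4 = d * inner22 x y"
proof -
  let ?q = "\<lambda>x y. inner22 (proj34 x) y"
  obtain v w k where V: "V = span {v, w}" and
    basis: "inner22 v v = 1" "inner22 w w = 1" "inner22 v w = 0" and
    circle: "\<And>\<theta>::real. ?q (cos \<theta> *\<^sub>R v + sin \<theta> *\<^sub>R w) (cos \<theta> *\<^sub>R v + sin \<theta> *\<^sub>R w) = (cosh k)\<^sup>2"
    using assms unfolding isoclinic_to_34_def constant_on_def Let_def by auto metis
  have "bilinear ?q"
    by (auto simp: bilinear_def inner22_proj34 linear_iff algebra_simps)
  then have q: "?q x y = (cosh k)\<^sup>2 / 1 * inner22 x y" if "x \<in> V" "y \<in> V" for x y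
    using circle that unfolding V
    by (intro constant_on_circle_imp_proportional[OF _ bilinear_inner22 _ inner22_commute basis])
      (auto simp: inner22_proj34)
  have q34: "x $ 3 * y $ 3 + x $ 4 * y $ 4 = (cosh k)\<^sup>2 * inner22 x y" if "x \<in> V" "y \<in> V" for x y
    using q[OF that] by (simp add: inner22_proj34)
  have q12: "x $ 1 * y $ 1 + x $ 2 * y $ 2 = ((cosh k)\<^sup>2 - 1) * inner22 x y"
    if "x \<in> V" "y \<in> V" for x y
    unfolding left_diff_distrib q34[OF that, symmetric] by (simp add: inner22_def)
  show ?thesis by (rule that[OF q12 q34])
qed

lemma isoclinic_to_12_proportional:
  assumes "isoclinic_to_12 V"
  obtains c d where
    "\<And>x y. x \<in> V \<Longrightarrow> y \<in> V \<Longrightarrow> x $ 1 * y $ 1 + x $ 2 * y $ 2 = c * inner22 x y"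
    "\<And>x y. x \<in> V \<Longrightarrow> y \<in> V \<Longrightarrow> x $ 3 * y $ 3 + x $ 4 * y $ 4 = d * inner22 x y"
proof -
  let ?q = "\<lambda>x y. inner22 (proj12 x) y"
  obtain v w k where V: "V = span {v, w}" and
    basis: "inner22 v v = -1" "inner22 w w = -1" "inner22 v w = 0" and
    circle: "\<And>\<theta>::real. ?q (cos \<theta> *\<^sub>R v + sin \<theta> *\<^sub>R w) (cos \<theta> *\<^sub>R v + sin \<theta> *\<^sub>R w) = - (cosh k)\<^sup>2"
    using assms unfolding isoclinic_to_12_def constant_on_def Let_def by auto metis
  have "bilinear ?q"
    by (auto simp: bilinear_def inner22_proj12 linear_iff algebra_simps)
  then have q: "?q x y = - (cosh k)\<^sup>2 / - 1 * inner22 x y" if "x \<in> V" "y \<in> V" for x y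
    using circle that unfolding V
    by (intro constant_on_circle_imp_proportional[OF _ bilinear_inner22 _ inner22_commute basis])
      (auto simp: inner22_proj12)
  have q12: "x $ 1 * y $ 1 + x $ 2 * y $ 2 = - (cosh k)\<^sup>2 * inner22 x y" if "x \<in> V" "y \<in> V" for x y
    using q[OF that] by (simp add: inner22_proj12)
  have q34: "x $ 3 * y $ 3 + x $ 4 * y $ 4 = (1 + - (cosh k)\<^sup>2) * inner22 x y"
    if "x \<in> V" "y \<in> V" for x y
    unfolding distrib_right q12[OF that, symmetric] by (simp add: inner22_def)
  show ?thesis by (rule that[OF q12 q34])
qed

section \<open>The Cauchy-Riemann equation and its conjugate\<close>

lemma linear_complex_plane:
  fixes D :: "complex \<Rightarrow> 'a::real_vector"
  assumes "linear D"
  shows "D h = Re h *\<^sub>R D 1 + Im h *\<^sub>R D \<i>"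
proof -
  have "D h = D (Re h *\<^sub>R 1 + Im h *\<^sub>R \<i>)" by (rule arg_cong[where f = D]) (simp add: complex_eq_iff)
  then show ?thesis by (simp only: linear_add[OF assms] linear_scale[OF assms])
qed

lemma Cauchy_Riemann_imp_has_field_derivative:
  assumes "(g has_derivative D) (at p)" and "D \<i> = \<i> * D 1"
  shows "(g has_field_derivative D 1) (at p)"
proof -
  have "D h = D 1 * h" for h
    using linear_complex_plane[OF has_derivative_linear[OF assms(1)], of h] assms(2)
    by (simp add: complex_eq_iff algebra_simps)
  then have "D = (*) (D 1)" by (rule ext)
  then show ?thesis
    using assms(1) by (simp add: has_field_derivative_def)
qed

lemma holomorphic_on_Cauchy_Riemann:
  assumes "open M" "\<And>p. p \<in> M \<Longrightarrow> (g has_derivative D p) (at p)"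
    and "\<And>p. p \<in> M \<Longrightarrow> D p \<i> = \<i> * D p 1"
  shows "g holomorphic_on M"
  using assms Cauchy_Riemann_imp_has_field_derivative by (metis holomorphic_on_open)

text \<open>
  The functions \<open>P = g\<^sub>u - i g\<^sub>v\<close> and \<open>Q = g\<^sub>u + i g\<^sub>v\<close> have product zero, and the claim is that
  one of them vanishes identically. Two continuous functions need not behave like this; here \<open>P\<close>
  turns out to be holomorphic on all of \<open>M\<close>, and the identity theorem applies to it.
\<close>

lemma holomorphic_or_antiholomorphic:
  fixes g :: "complex \<Rightarrow> complex"
  assumes M: "open M" "connected M"
    and g: "\<And>p. p \<in> M \<Longrightarrow> (g has_derivative D p) (at p)"
    and cont_Q: "continuous_on M (\<lambda>p. D p 1 + \<i> * D p \<i>)"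
    and P: "\<And>p. p \<in> M \<Longrightarrow> ((\<lambda>p. D p 1 - \<i> * D p \<i>) has_derivative E p) (at p)"
    and cont_E: "\<And>h. continuous_on M (\<lambda>p. E p h)"
    and null: "\<And>p. p \<in> M \<Longrightarrow> (D p 1)\<^sup>2 + (D p \<i>)\<^sup>2 = 0"
  shows "(\<forall>p\<in>M. D p \<i> = \<i> * D p 1) \<or> (\<forall>p\<in>M. D p \<i> = - \<i> * D p 1)"
proof -
  define P where "P = (\<lambda>p. D p 1 - \<i> * D p \<i>)"
  define Q where "Q = (\<lambda>p. D p 1 + \<i> * D p \<i>)"
  have P': "(P has_derivative E p) (at p)" if "p \<in> M" for p
    using P[OF that] by (simp add: P_def)
  have cont_P: "continuous_on M P"
    using P' by (meson continuous_at_imp_continuous_on has_derivative_continuous)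
  have open_nonzero: "open {p \<in> M. F p \<noteq> 0}" if "continuous_on M F" for F :: "complex \<Rightarrow> complex"
  proof -
    have "open (M \<inter> F -` (- {0}))"
      using that M(1) by (intro continuous_open_preimage) auto
    also have "M \<inter> F -` (- {0}) = {p \<in> M. F p \<noteq> 0}" by auto
    finally show ?thesis .
  qed
  have PQ: "P p = 0 \<or> Q p = 0" if "p \<in> M" for p
  proof -
    have "P p * Q p = (D p 1)\<^sup>2 + (D p \<i>)\<^sup>2"
      by (simp add: P_def Q_def power2_eq_square algebra_simps)
    then show ?thesis using null[OF that] by simp
  qed

  define A where "A = {p \<in> M. P p \<noteq> 0}"
  have "open A" unfolding A_def by (rule open_nonzero[OF cont_P])
  have CR_A: "D p \<i> = \<i> * D p 1" if "p \<in> A" for p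
    using PQ[of p] that by (auto simp: A_def Q_def complex_eq_iff)
  have "g holomorphic_on A"
    by (rule holomorphic_on_Cauchy_Riemann[OF \<open>open A\<close> g CR_A]) (auto simp: A_def)
  have P_deriv: "P p = 2 * deriv g p" if "p \<in> A" for p
  proof -
    have "deriv g p = D p 1"
      using Cauchy_Riemann_imp_has_field_derivative[OF g CR_A[OF that]] that
      by (auto simp: A_def intro: DERIV_imp_deriv)
    then show ?thesis using CR_A[OF that] by (simp add: P_def)
  qed
  have "P holomorphic_on A"
    by (rule holomorphic_transform[of "\<lambda>p. 2 * deriv g p"])
      (auto intro!: holomorphic_intros \<open>g holomorphic_on A\<close> \<open>open A\<close> simp: P_deriv)
  have CR_P_A: "E p \<i> = \<i> * E p 1" if p: "p \<in> A" for p
  proof -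
    have "(P has_field_derivative deriv P p) (at p)"
      using \<open>P holomorphic_on A\<close> \<open>open A\<close> p by (rule holomorphic_derivI)
    then have "E p = (*) (deriv P p)"
      using P' p by (auto simp: A_def has_field_derivative_def dest: has_derivative_unique)
    then show ?thesis by simp
  qed

  have CR_P: "E p \<i> = \<i> * E p 1" if p: "p \<in> M" for p
  proof (rule ccontr)
    \<comment> \<open>A failure persists on an open set. That set is disjoint from \<open>A\<close>, so \<open>P\<close> vanishes on it,
        and then so does the derivative of \<open>P\<close>.\<close>
    define U where "U = {p \<in> M. E p \<i> - \<i> * E p 1 \<noteq> 0}"
    assume "E p \<i> \<noteq> \<i> * E p 1"
    with p have "p \<in> U" by (simp add: U_def)
    have "open U" unfolding U_def
      by (rule open_nonzero) (intro continuous_intros cont_E)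
    have "P x = 0" if "x \<in> U" for x
      using CR_P_A[of x] that by (auto simp: U_def A_def)
    then have "((\<lambda>_. 0) has_derivative E p) (at p)"
      using has_derivative_transform_within_open[OF P'[OF p] \<open>open U\<close> \<open>p \<in> U\<close>] by simp
    then have "E p = (\<lambda>_. 0)"
      using has_derivative_unique has_derivative_const by blast
    with \<open>p \<in> U\<close> show False by (simp add: U_def)
  qed
  have holo_P: "P holomorphic_on M"
    by (rule holomorphic_on_Cauchy_Riemann[OF M(1) P' CR_P])

  show ?thesis
  proof (cases "A = {}")
    case True
    then have "D p \<i> = - \<i> * D p 1" if "p \<in> M" for p
      using that by (auto simp: A_def P_def complex_eq_iff)
    then show ?thesis by blast
  next
    case False
    define U where "U = {p \<in> M. Q p \<noteq> 0}"
    have "open U" unfolding U_def using cont_Q by (intro open_nonzero) (simp add: Q_def)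
    have "U = {}"
    proof (rule ccontr)
      assume "U \<noteq> {}"
      have "P x = 0" if "x \<in> U" for x
        using PQ[of x] that by (auto simp: U_def)
      moreover have "U \<subseteq> M" by (auto simp: U_def)
      ultimately have "P p = 0" if "p \<in> M" for p
        using analytic_continuation_open[OF \<open>open U\<close> M(1) \<open>U \<noteq> {}\<close> M(2) _ holo_P, of "\<lambda>_. 0" p] that
        by simp
      with False show False by (auto simp: A_def)
    qed
    then have "D p \<i> = \<i> * D p 1" if "p \<in> M" for p
      using that by (auto simp: U_def Q_def complex_eq_iff)
    then show ?thesis by blast
  qed
qed

section \<open>Linear images of smooth maps\<close>

lemma smooth_map_on_C2:
  assumes "smooth_map_on f M"
  shows "p \<in> M \<Longrightarrow> (f has_derivative frechet_derivative f (at p)) (at p)"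
    and "p \<in> M \<Longrightarrow> ((\<lambda>x. frechet_derivative f (at x) h) has_derivative
            frechet_derivative (\<lambda>x. frechet_derivative f (at x) h) (at p)) (at p)"
    and "continuous_on M (\<lambda>p. frechet_derivative (\<lambda>x. frechet_derivative f (at x) h) (at p) k)"
proof -
  have "Ck_on (Suc (Suc 0)) f M" using assms by (simp add: smooth_map_on_def)
  then show "p \<in> M \<Longrightarrow> (f has_derivative frechet_derivative f (at p)) (at p)"
    "p \<in> M \<Longrightarrow> ((\<lambda>x. frechet_derivative f (at x) h) has_derivative
            frechet_derivative (\<lambda>x. frechet_derivative f (at x) h) (at p)) (at p)"
    "continuous_on M (\<lambda>p. frechet_derivative (\<lambda>x. frechet_derivative f (at x) h) (at p) k)"
    by (simp_all add: frechet_derivative_works[symmetric])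
qed

text \<open>
  The conclusion is stated with one sign \<open>s\<close>: the imaginary part has to be multiplied by \<open>s\<close> to
  make \<open>L \<circ> f\<close> holomorphic. For \<open>g = L \<circ> f\<close>, the imaginary part of \<open>cnj g\<^sub>u g\<^sub>v\<close> is the
  Jacobian determinant of \<open>g\<close>.
\<close>

lemma linear_image_holomorphic_up_to_sign:
  fixes f :: "complex \<Rightarrow> real^4" and L :: "real^4 \<Rightarrow> complex"
  assumes M: "open M" "connected M" and f: "smooth_map_on f M" and L: "bounded_linear L"
    and null: "\<And>p. p \<in> M \<Longrightarrow> (L (deriv_u f p))\<^sup>2 + (L (deriv_v f p))\<^sup>2 = 0"
  shows "\<exists>s\<in>{1, -1}. (\<lambda>p. Complex (Re (L (f p))) (s * Im (L (f p)))) holomorphic_on M"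
    and "(\<And>p. p \<in> M \<Longrightarrow> Im (cnj (L (deriv_u f p)) * L (deriv_v f p)) \<ge> 0)
           \<Longrightarrow> (\<lambda>p. L (f p)) holomorphic_on M"
proof -
  let ?D = "\<lambda>p h. L (frechet_derivative f (at p) h)"
  let ?E = "\<lambda>p h k. L (frechet_derivative (\<lambda>x. frechet_derivative f (at x) h) (at p) k)"
  note smooth = smooth_map_on_C2[OF f]
  have D: "((\<lambda>p. L (f p)) has_derivative ?D p) (at p)" if "p \<in> M" for p
    by (rule bounded_linear.has_derivative[OF L smooth(1)[OF that]])
  have E: "((\<lambda>p. ?D p h) has_derivative ?E p h) (at p)" if "p \<in> M" for p h
    by (rule bounded_linear.has_derivative[OF L smooth(2)[OF that]])
  have cont_D: "continuous_on M (\<lambda>p. ?D p h)" for h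
    using E by (meson continuous_at_imp_continuous_on has_derivative_continuous)
  have cont_E: "continuous_on M (\<lambda>p. ?E p h k)" for h k
    by (rule bounded_linear.continuous_on[OF L smooth(3)])
  have CR: "(\<forall>p\<in>M. ?D p \<i> = \<i> * ?D p 1) \<or> (\<forall>p\<in>M. ?D p \<i> = - \<i> * ?D p 1)"
    by (rule holomorphic_or_antiholomorphic[OF M D,
          where E = "\<lambda>p k. ?E p 1 k - \<i> * ?E p \<i> k"])
      (use null in \<open>auto intro!: derivative_eq_intros continuous_intros E cont_D cont_E
          simp: deriv_u_def deriv_v_def\<close>)
  have pos: "(\<lambda>p. L (f p)) holomorphic_on M" if "\<forall>p\<in>M. ?D p \<i> = \<i> * ?D p 1"
    using that by (intro holomorphic_on_Cauchy_Riemann[OF M(1) D]) auto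
  show "\<exists>s\<in>{1, -1}. (\<lambda>p. Complex (Re (L (f p))) (s * Im (L (f p)))) holomorphic_on M"
    using CR
  proof
    assume "\<forall>p\<in>M. ?D p \<i> = \<i> * ?D p 1"
    from pos[OF this] show ?thesis by simp
  next
    assume anti: "\<forall>p\<in>M. ?D p \<i> = - \<i> * ?D p 1"
    have "(\<lambda>p. cnj (L (f p))) holomorphic_on M"
      by (rule holomorphic_on_Cauchy_Riemann[OF M(1), where D = "\<lambda>p h. cnj (?D p h)"])
        (use anti in \<open>auto intro: bounded_linear.has_derivative[OF bounded_linear_cnj] D\<close>)
    moreover have "cnj z = Complex (Re z) (-1 * Im z)" for z by (simp add: complex_eq_iff)
    ultimately show ?thesis by auto
  qed
  assume orient: "\<And>p. p \<in> M \<Longrightarrow> Im (cnj (L (deriv_u f p)) * L (deriv_v f p)) \<ge> 0"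
  have "\<forall>p\<in>M. ?D p \<i> = \<i> * ?D p 1"
    using CR
  proof
    assume anti: "\<forall>p\<in>M. ?D p \<i> = - \<i> * ?D p 1"
    have "?D p 1 = 0" if "p \<in> M" for p
    proof -
      \<comment> \<open>Under the conjugate equation the Jacobian is \<open>- \<bar>g\<^sub>u\<bar>\<^sup>2\<close>.\<close>
      have "(Re (?D p 1))\<^sup>2 + (Im (?D p 1))\<^sup>2 \<le> 0"
        using orient[OF that] anti that
        by (simp add: deriv_u_def deriv_v_def power2_eq_square)
      then show ?thesis by (simp add: complex_eq_iff sum_power2_le_zero_iff)
    qed
    with anti show ?thesis by simp
  qed auto
  then show "(\<lambda>p. L (f p)) holomorphic_on M" by (rule pos)
qed

section \<open>Isoclinic conformal immersions\<close>

lemma bounded_linear_Complex_nth: "bounded_linear (\<lambda>v::real^'n. Complex (v $ i) (v $ j))"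
  by (rule linear_conv_bounded_linear[THEN iffD1]) (simp add: linear_iff complex_eq_iff)

text \<open>
  Orthogonality says \<open>z cnj w = - cnj z w\<close>, so \<open>cnj w (z\<^sup>2 + w\<^sup>2) = w (\<bar>w\<bar>\<^sup>2 - \<bar>z\<bar>\<^sup>2) = 0\<close>.
\<close>

lemma orthogonal_same_length_imp_null:
  fixes z w :: complex
  assumes "(Re z)\<^sup>2 + (Im z)\<^sup>2 = (Re w)\<^sup>2 + (Im w)\<^sup>2" and "Re z * Re w + Im z * Im w = 0"
  shows "z\<^sup>2 + w\<^sup>2 = 0"
proof -
  have "cnj z * z = cnj w * w" "cnj z * w + cnj w * z = 0"
    using assms by (auto simp: complex_eq_iff power2_eq_square algebra_simps)
  moreover have "cnj w * (z\<^sup>2 + w\<^sup>2) = z * (cnj z * w + cnj w * z) + w * (cnj w * w - cnj z * z)"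
    by (simp add: power2_eq_square algebra_simps)
  ultimately have "cnj w * (z\<^sup>2 + w\<^sup>2) = 0" by simp
  moreover have "z = 0" if "w = 0"
    using assms(1) that by (simp add: complex_eq_iff sum_power2_eq_zero_iff)
  ultimately show ?thesis by (cases "w = 0") simp_all
qed

lemma isoclinic_projections_null:
  assumes f: "isoclinic_immersion_on f M" and p: "p \<in> M"
  shows "(Complex (deriv_u f p $ 1) (deriv_u f p $ 2))\<^sup>2
           + (Complex (deriv_v f p $ 1) (deriv_v f p $ 2))\<^sup>2 = 0" (is ?null12)
    and "(Complex (deriv_u f p $ 3) (deriv_u f p $ 4))\<^sup>2
           + (Complex (deriv_v f p $ 3) (deriv_v f p $ 4))\<^sup>2 = 0" (is ?null34)
proof -
  let ?V = "tangent_plane f p" and ?a = "deriv_u f p" and ?b = "deriv_v f p"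
  have V: "?a \<in> ?V" "?b \<in> ?V"
    by (auto simp: tangent_plane_def deriv_u_def deriv_v_def)
  have conf: "inner22 ?a ?a = inner22 ?b ?b" "inner22 ?a ?b = 0"
    using f p by (auto simp: isoclinic_immersion_on_def conformal_immersion_on_def)
  have "isoclinic_to_34 ?V \<or> isoclinic_to_12 ?V"
    using f p by (auto simp: isoclinic_immersion_on_def)
  then obtain c d where
    cd: "\<And>x y. x \<in> ?V \<Longrightarrow> y \<in> ?V \<Longrightarrow> x $ 1 * y $ 1 + x $ 2 * y $ 2 = c * inner22 x y"
      "\<And>x y. x \<in> ?V \<Longrightarrow> y \<in> ?V \<Longrightarrow> x $ 3 * y $ 3 + x $ 4 * y $ 4 = d * inner22 x y"
    by (metis isoclinic_to_34_proportional isoclinic_to_12_proportional)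
  show ?null12 ?null34
    using cd[OF V(1) V(1)] cd[OF V(2) V(2)] cd[OF V] conf
    by (intro orthogonal_same_length_imp_null; simp add: power2_eq_square)+
qed

theorem theorem3p5:
  fixes M :: "complex set" and r :: real and f :: "complex \<Rightarrow> real^4"
  assumes "open M" and "connected M" and "simply_connected M"
    and "r > 0" and "complex_of_real ` {-r<..<r} \<subseteq> M"
    and "isoclinic_immersion_on f M"
  shows "(orientation_compatible_on f M \<longrightarrow>
           (\<exists>\<Psi> \<Phi>. \<Psi> holomorphic_on M \<and> \<Phi> holomorphic_on M \<and>
             (\<forall>w\<in>M. f w = vector [Re (\<Psi> w), Im (\<Psi> w), Re (\<Phi> w), Im (\<Phi> w)]))) \<and>
         (\<exists>\<sigma>\<in>{1, -1}. \<exists>\<tau>\<in>{1, -1}. \<exists>\<Psi> \<Phi>. \<Psi> holomorphic_on M \<and> \<Phi> holomorphic_on M \<and>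
             (\<forall>w\<in>M. f w = vector [Re (\<Psi> w), \<sigma> * Im (\<Psi> w), Re (\<Phi> w), \<tau> * Im (\<Phi> w)]))"
proof -
  have "smooth_map_on f M"
    using assms(6) by (simp add: isoclinic_immersion_on_def conformal_immersion_on_def immersion_on_def)
  note holo = linear_image_holomorphic_up_to_sign[OF assms(1,2) this bounded_linear_Complex_nth]
  note holo12 = holo[of 1 2, OF isoclinic_projections_null(1)[OF assms(6)]]
  note holo34 = holo[of 3 4, OF isoclinic_projections_null(2)[OF assms(6)]]
  show ?thesis
  proof (intro conjI impI)
    assume "orientation_compatible_on f M"
    then have "(\<lambda>w. Complex (f w $ 1) (f w $ 2)) holomorphic_on M"
      "(\<lambda>w. Complex (f w $ 3) (f w $ 4)) holomorphic_on M"
      by (auto intro!: holo12(2) holo34(2) simp: orientation_compatible_on_def algebra_simps)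
    then show "\<exists>\<Psi> \<Phi>. \<Psi> holomorphic_on M \<and> \<Phi> holomorphic_on M \<and>
             (\<forall>w\<in>M. f w = vector [Re (\<Psi> w), Im (\<Psi> w), Re (\<Phi> w), Im (\<Phi> w)])"
      by (intro exI[of _ "\<lambda>w. Complex (f w $ 1) (f w $ 2)"]
            exI[of _ "\<lambda>w. Complex (f w $ 3) (f w $ 4)"] conjI)
        (auto simp: vec_eq_iff forall_4 vector_4)
  next
    obtain \<sigma> \<tau> :: real where signs: "\<sigma> \<in> {1, -1}" "\<tau> \<in> {1, -1}"
      and "(\<lambda>w. Complex (f w $ 1) (\<sigma> * f w $ 2)) holomorphic_on M"
        "(\<lambda>w. Complex (f w $ 3) (\<tau> * f w $ 4)) holomorphic_on M"
      using holo12(1) holo34(1) by (simp only: complex.sel) blast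
    then show "\<exists>\<sigma>\<in>{1, -1}. \<exists>\<tau>\<in>{1, -1}. \<exists>\<Psi> \<Phi>. \<Psi> holomorphic_on M \<and> \<Phi> holomorphic_on M \<and>
             (\<forall>w\<in>M. f w = vector [Re (\<Psi> w), \<sigma> * Im (\<Psi> w), Re (\<Phi> w), \<tau> * Im (\<Phi> w)])"
      by (intro bexI[OF _ signs(1)] bexI[OF _ signs(2)]
            exI[of _ "\<lambda>w. Complex (f w $ 1) (\<sigma> * f w $ 2)"]
            exI[of _ "\<lambda>w. Complex (f w $ 3) (\<tau> * f w $ 4)"] conjI)
        (use signs in \<open>auto simp: vec_eq_iff forall_4 vector_4\<close>)
  qed
qed

end
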